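(* If $\{c_\lambda\}\in l_2(\Lambda)$, $b\in\mathbb{C}$ and $$b\,\mathbf{e}_\sharp+\sum_{\lambda\in\Lambda}c_\lambda\mathbf{e}_\lambda=0$$ (the series converging in $L_2(\mathbb{R})$), then $c_\lambda=0$ for all $\lambda$.
   Context: For $\lambda=(p,\theta)\in\mathbb{R}\times\mathbb{R}$ the Gabor function is $\mathbf{e}_\lambda(x)=2^{1/4}\exp(-\pi(x-p)^2+2\pi i\theta x)$, $x\in\mathbb{R}$. $\Lambda=\mathbb{Z}\times\mathbb{Z}$ and $\sharp=(1/2,1/2)$. *)

theory Defs
  imports "HOL-Analysis.Analysis"
begin

definition gabor :: "real \<times> real \<Rightarrow> real \<Rightarrow> complex" where
  "gabor l x = (case l of (p, \<theta>) \<Rightarrow>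
     complex_of_real (2 powr (1/4)) *
       exp (complex_of_real (- pi * (x - p)\<^sup>2) + 2 * complex_of_real pi * \<i> * complex_of_real (\<theta> * x)))"

definition Lambda :: "(real \<times> real) set" where
  "Lambda = \<int> \<times> \<int>"

definition sharp :: "real \<times> real" where
  "sharp = (1/2, 1/2)"

definition little_l2 :: "('a \<Rightarrow> complex) \<Rightarrow> 'a set \<Rightarrow> bool" where
  "little_l2 c A \<longleftrightarrow> (\<lambda>l. (cmod (c l))\<^sup>2) summable_on A"

text \<open>Elements of $L_2(\mathbb{R})$ are represented by Borel functions, with equality in
  $L_2(\mathbb{R})$ being equality almost everywhere.\<close>

definition L2 :: "(real \<Rightarrow> complex) set" where
  "L2 = {f \<in> borel_measurable lborel. integrable lborel (\<lambda>x. (cmod (f x))\<^sup>2)}"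

definition L2_norm :: "(real \<Rightarrow> complex) \<Rightarrow> real" where
  "L2_norm f = sqrt (LINT x|lborel. (cmod (f x))\<^sup>2)"

text \<open>The analogue of \<open>has_sum\<close> in the norm of $L_2(\mathbb{R})$ (unordered summation). Membership
  of the terms and of the sum in \<open>L2\<close> is required, so that \<open>L2_norm\<close> is only ever
  applied to square-integrable functions.\<close>

definition has_sum_L2 :: "('a \<Rightarrow> real \<Rightarrow> complex) \<Rightarrow> (real \<Rightarrow> complex) \<Rightarrow> 'a set \<Rightarrow> bool" where
  "has_sum_L2 f s A \<longleftrightarrow> (\<forall>l\<in>A. f l \<in> L2) \<and> s \<in> L2 \<and>
     ((\<lambda>F. L2_norm (\<lambda>x. (\<Sum>l\<in>F. f l x) - s x)) \<longlongrightarrow> 0) (finite_subsets_at_top A)"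

end

theory Submission
  imports Defs "HOL-Real_Asymp.Real_Asymp" "HOL-Probability.Sinc_Integral"
begin

text \<open>
  Let \<open>\<gamma>\<close> be Bastiaans' dual window
  \<open>\<gamma>(x) = \<Sum>k. (-1)^k exp (\<pi> (x^2 - (k + 1/2)^2)) 1[\<bar>x\<bar> \<le> k + 1/2]\<close>. Its bilinear pairing with \<open>gabor (m, n)\<close>
  is an explicit theta-type series: at integer points \<open>(m, n) \<noteq> 0\<close> it vanishes by antisymmetry, at \<open>0\<close>
  it is a nonzero constant \<open>A\<close>, and at points with half-odd-integer coordinates it has modulus
  \<open>\<kappa> / \<bar>m + i n\<bar>\<close> with \<open>\<kappa> > 0\<close>.

  The shifts \<open>\<gamma>\<^bsub>p,q\<^esub>(x) = \<gamma>(x - p) exp (- 2 \<pi> i q x)\<close> do not lie in \<open>L2\<close>, but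
  \<open>\<gamma>\<^bsub>p,q\<^esub> + \<gamma>\<^bsub>p,q+1\<^esub>\<close> is \<open>O(1 / \<bar>x\<bar>)\<close> and does. Pairing the relation with these sums shows that
  \<open>D q = A c\<^bsub>p,q\<^esub> + b \<langle>e\<^bsub>sharp\<^esub>, \<gamma>\<^bsub>p,q\<^esub>\<rangle>\<close> satisfies \<open>D (q + 1) = - D q\<close>. Since \<open>D q\<close> tends to \<open>0\<close>,
  it vanishes identically, so \<open>\<bar>c\<^bsub>\<lambda>\<^esub>\<bar>\<close> is \<open>\<bar>b\<bar>\<close> times a constant multiple of \<open>1 / \<bar>\<lambda> - sharp\<bar>\<close>,
  which is not square summable over the lattice unless \<open>b = 0\<close>.
\<close>

subsection \<open>The dual window\<close>

text \<open>Bastiaans' dual window of the Gaussian. It is bounded, but its size near \<open>\<plusminus>(k + 1/2)\<close> is of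
  order \<open>exp (- 2 \<pi> k d)\<close> at distance \<open>d\<close> inside, so it just fails to be square integrable.\<close>

definition node :: "nat \<Rightarrow> real" where
  "node k = real k + 1/2"

definition dual_term :: "nat \<Rightarrow> real \<Rightarrow> real" where
  "dual_term k x = (-1) ^ k * exp (pi * (x\<^sup>2 - (node k)\<^sup>2)) * indicator {- node k..node k} x"

definition dual :: "real \<Rightarrow> real" where
  "dual x = (\<Sum>k. dual_term k x)"

lemma node_pos: "node k > 0"
  by (simp add: node_def add_nonneg_pos)

lemma dual_term_measurable [measurable]: "dual_term k \<in> borel_measurable borel"
  unfolding dual_term_def by measurable

lemma dual_measurable [measurable]: "dual \<in> borel_measurable borel"
  unfolding dual_def by measurable

lemma summable_exp_node: "summable (\<lambda>k. exp (2 * pi * \<mu> * node k - pi * (node k)\<^sup>2))"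
proof (rule summable_comparison_test_bigo)
  show "summable (\<lambda>k. norm (1 / real k ^ 2))"
    using inverse_power_summable[of 2, where ?'a = real] by (simp add: divide_inverse)
  show "(\<lambda>k. exp (2 * pi * \<mu> * node k - pi * (node k)\<^sup>2)) \<in> O(\<lambda>k. 1 / real k ^ 2)"
    unfolding node_def by real_asymp
qed

text \<open>The extra factor \<open>2 * node k\<close> is the length of the support of
  \<open>dual_term k\<close>; it turns a bound on the supremum into a bound on the integral.\<close>

lemma summable_node_exp_node: "summable (\<lambda>k. 2 * node k * exp (2 * pi * \<mu> * node k - pi * (node k)\<^sup>2))"
proof (rule summable_comparison_test_bigo)
  show "summable (\<lambda>k. norm (1 / real k ^ 2))"
    using inverse_power_summable[of 2, where ?'a = real] by (simp add: divide_inverse)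
  show "(\<lambda>k. 2 * node k * exp (2 * pi * \<mu> * node k - pi * (node k)\<^sup>2)) \<in> O(\<lambda>k. 1 / real k ^ 2)"
    unfolding node_def by real_asymp
qed

lemma summable_abs_dual_term: "summable (\<lambda>k. \<bar>dual_term k x\<bar>)"
proof (rule summable_comparison_test')
  show "summable (\<lambda>k. exp (pi * x\<^sup>2) * exp (2 * pi * 0 * node k - pi * (node k)\<^sup>2))"
    by (intro summable_mult summable_exp_node)
  show "norm \<bar>dual_term k x\<bar> \<le> exp (pi * x\<^sup>2) * exp (2 * pi * 0 * node k - pi * (node k)\<^sup>2)" for k
    by (auto simp: dual_term_def abs_mult power_abs algebra_simps exp_diff indicator_def divide_inverse exp_minus simp flip: exp_add)
qed

section \<open>Termwise pairing of Gabor functions with the dual window\<close>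

lemma gabor_eq:
  "gabor (m, n) x = complex_of_real (2 powr (1/4) * exp (- pi * (x - m)\<^sup>2)) * cis (2 * pi * n * x)"
proof -
  have "complex_of_real (exp (- pi * (x - m)\<^sup>2)) = exp (complex_of_real (- pi * (x - m)\<^sup>2))"
    by (rule exp_of_real[symmetric])
  then show ?thesis
    unfolding gabor_def cis_conv_exp of_real_mult[of "2 powr (1/4)"] by (simp only: prod.case exp_add) (simp add: mult_ac)
qed

lemma norm_gabor: "norm (gabor (m, n) x) = 2 powr (1/4) * exp (- pi * (x - m)\<^sup>2)"
  unfolding gabor_eq by (simp add: norm_mult del: of_real_mult)

lemma gabor_measurable [measurable]: "gabor (m, n) \<in> borel_measurable borel"
  unfolding gabor_eq[abs_def] cis_conv_exp by measurable

text \<open>The value of \<open>\<integral> gabor (m, n) x * dual_term k x dx\<close>; the product of the two Gaussians is a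
  complex exponential on the interval between the nodes.\<close>

definition pair_term :: "real \<Rightarrow> real \<Rightarrow> nat \<Rightarrow> complex" where
  "pair_term m n k = complex_of_real (2 powr (1/4) * exp (- pi * m\<^sup>2) * (-1) ^ k * exp (- pi * (node k)\<^sup>2)) *
     (if m = 0 \<and> n = 0 then of_real (2 * node k)
      else (exp (2 * pi * Complex m n * node k) - exp (- (2 * pi * Complex m n * node k))) / (2 * pi * Complex m n))"

lemma has_bochner_integral_exp_Icc:
  fixes w :: complex
  assumes "a > 0"
  shows "has_bochner_integral lborel (\<lambda>x. indicator {- a..a} x *\<^sub>R exp (w * of_real x))
     (if w = 0 then of_real (2 * a) else (exp (w * a) - exp (- (w * a))) / w)"
proof (cases "w = 0")
  case True
  have "has_bochner_integral lborel (\<lambda>x. indicator {- a..a} x *\<^sub>R (1::complex)) (of_real a - of_real (-a))"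
    using assms by (intro has_bochner_integral_FTC_Icc) (auto intro!: derivative_eq_intros)
  then show ?thesis using True by simp
next
  case False
  have "has_bochner_integral lborel (\<lambda>x. indicator {- a..a} x *\<^sub>R exp (w * of_real x))
     (exp (w * of_real a) / w - exp (w * of_real (- a)) / w)"
  proof (intro has_bochner_integral_FTC_Icc)
    show "((\<lambda>x. exp (w * of_real x) / w) has_vector_derivative exp (w * of_real x)) (at x within {- a..a})" for x
    proof (rule has_vector_derivative_real_field)
      show "((\<lambda>z. exp (w * z) / w) has_field_derivative exp (w * of_real x)) (at (of_real x))"
        using False by (auto intro!: derivative_eq_intros)
    qed
  qed (use assms in \<open>auto intro!: continuous_intros\<close>)
  then show ?thesis using False by (simp add: diff_divide_distrib)
qed

text \<open>The squares of \<open>x\<close> in the two exponents cancel, leaving an exponent linear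
  in \<open>x\<close> with complex rate 2 pi (m + i n).\<close>

lemma gabor_dual_term:
  "gabor (m, n) x * of_real (dual_term k x) =
     complex_of_real (2 powr (1/4) * exp (- pi * m\<^sup>2) * (-1) ^ k * exp (- pi * (node k)\<^sup>2)) *
       (indicator {- node k..node k} x *\<^sub>R exp (2 * pi * Complex m n * of_real x))"
proof -
  have "exp (2 * pi * Complex m n * of_real x) = of_real (exp (2 * pi * m * x)) * cis (2 * pi * n * x)"
    by (subst exp_eq_polar) (simp add: mult_ac)
  moreover have "exp (- pi * (x - m)\<^sup>2) * exp (pi * (x\<^sup>2 - (node k)\<^sup>2)) =
      exp (- pi * m\<^sup>2) * exp (- pi * (node k)\<^sup>2) * exp (2 * pi * m * x)"
    unfolding exp_add[symmetric] by (rule arg_cong[where f=exp]) (simp add: power2_eq_square algebra_simps)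
  then have "complex_of_real (exp (- pi * (x - m)\<^sup>2)) * of_real (exp (pi * (x\<^sup>2 - (node k)\<^sup>2))) =
      of_real (exp (- pi * m\<^sup>2)) * of_real (exp (- pi * (node k)\<^sup>2)) * of_real (exp (2 * pi * m * x))"
    by (metis of_real_mult)
  ultimately show ?thesis
    by (simp add: gabor_eq dual_term_def scaleR_conv_of_real mult_ac)
qed

text \<open>On the support the linear exponent is largest at a node, and exp (- pi m^2) is bounded
  by 1. The bound is constant on the support, hence easy to integrate.\<close>

lemma norm_gabor_dual_term:
  "norm (gabor (m, n) x * of_real (dual_term k x)) \<le>
     2 powr (1/4) * exp (2 * pi * \<bar>m\<bar> * node k - pi * (node k)\<^sup>2) * indicator {- node k..node k} x"
proof (cases "x \<in> {- node k..node k}")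
  case True
  have "m * x \<le> \<bar>m\<bar> * node k"
  proof -
    have "m * x \<le> \<bar>m\<bar> * \<bar>x\<bar>"
      by (metis abs_ge_self abs_mult)
    also have "\<dots> \<le> \<bar>m\<bar> * node k"
      using True by (intro mult_left_mono) auto
    finally show ?thesis .
  qed
  then have "2 * pi * (m * x) \<le> 2 * pi * \<bar>m\<bar> * node k"
    unfolding mult.assoc by (intro mult_left_mono) auto
  moreover have "- pi * (x - m)\<^sup>2 + pi * (x\<^sup>2 - (node k)\<^sup>2) = 2 * pi * (m * x) - pi * m\<^sup>2 - pi * (node k)\<^sup>2"
    by (simp add: power2_eq_square algebra_simps)
  moreover have "0 \<le> pi * m\<^sup>2"
    by simp
  ultimately have "- pi * (x - m)\<^sup>2 + pi * (x\<^sup>2 - (node k)\<^sup>2) \<le> 2 * pi * \<bar>m\<bar> * node k - pi * (node k)\<^sup>2"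
    by linarith
  then have "exp (- pi * (x - m)\<^sup>2) * exp (pi * (x\<^sup>2 - (node k)\<^sup>2)) \<le> exp (2 * pi * \<bar>m\<bar> * node k - pi * (node k)\<^sup>2)"
    unfolding exp_add[symmetric] by simp
  then show ?thesis
    using True by (simp add: norm_mult norm_gabor dual_term_def abs_mult norm_power mult.assoc)
qed (simp add: dual_term_def)

lemma gabor_dual_term_integral:
  "has_bochner_integral lborel (\<lambda>x. gabor (m, n) x * of_real (dual_term k x)) (pair_term m n k)"
proof -
  have "(2 * pi * Complex m n = 0) = (m = 0 \<and> n = 0)"
    by (simp add: complex_eq_iff)
  then show ?thesis
    unfolding gabor_dual_term pair_term_def
    by (intro has_bochner_integral_mult_right)
      (use has_bochner_integral_exp_Icc[OF node_pos, of k "2 * pi * Complex m n"] in \<open>simp only:\<close>)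
qed

text \<open>Series and integral may be exchanged because the L1 norms of the terms are summable; so
  \<open>dual\<close> itself, without damping, pairs with every Gabor function.\<close>

lemma gabor_dual_integrable: "integrable lborel (\<lambda>x. gabor (m, n) x * of_real (dual x))" (is ?thesis1)
  and gabor_dual_sums: "pair_term m n sums (LINT x|lborel. gabor (m, n) x * of_real (dual x))" (is ?thesis2)
proof -
  define f where "f k x = gabor (m, n) x * complex_of_real (dual_term k x)" for k x
  let ?B = "\<lambda>k. 2 powr (1/4) * exp (2 * pi * \<bar>m\<bar> * node k - pi * (node k)\<^sup>2)"
  have f: "has_bochner_integral lborel (f k) (pair_term m n k)" for k
    unfolding f_def by (rule gabor_dual_term_integral)
  have int: "integrable lborel (f k)" for k
    using f has_bochner_integral_iff by blast
  have norms: "summable (\<lambda>k. norm (f k x))" for x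
    unfolding f_def norm_mult using summable_abs_dual_term[of x] by (simp add: summable_mult)
  have ints: "summable (\<lambda>k. LINT x|lborel. norm (f k x))"
  proof (rule summable_comparison_test')
    show "summable (\<lambda>k. 2 powr (1/4) * (2 * node k * exp (2 * pi * \<bar>m\<bar> * node k - pi * (node k)\<^sup>2)))"
      by (intro summable_mult summable_node_exp_node)
    have "(LINT x|lborel. norm (f k x)) \<le> (LINT x|lborel. ?B k * indicator {- node k..node k} x)" for k
    proof (intro integral_mono integrable_norm int integrable_mult_right integrable_real_indicator)
      show "norm (f k x) \<le> ?B k * indicator {- node k..node k} x" for x
        unfolding f_def by (rule norm_gabor_dual_term)
    qed (simp_all add: emeasure_lborel_Icc_eq)
    moreover have "(LINT x|lborel. ?B k * indicator {- node k..node k} x) =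
      2 powr (1/4) * (2 * node k * exp (2 * pi * \<bar>m\<bar> * node k - pi * (node k)\<^sup>2))" for k
      using node_pos[of k] by (simp add: measure_lborel_Icc)
    moreover have "0 \<le> (LINT x|lborel. norm (f k x))" for k
      by simp
    ultimately show "norm (LINT x|lborel. norm (f k x)) \<le> 2 powr (1/4) * (2 * node k * exp (2 * pi * \<bar>m\<bar> * node k - pi * (node k)\<^sup>2))" for k
      by (metis abs_of_nonneg real_norm_def)
  qed
  have eq: "(\<Sum>k. f k x) = gabor (m, n) x * of_real (dual x)" for x
    unfolding f_def dual_def using summable_rabs_cancel[OF summable_abs_dual_term, of x]
    by (simp add: suminf_mult suminf_of_real summable_of_real)
  show ?thesis1
    using integrable_suminf[OF int _ ints] norms by (simp add: eq)
  have "integral\<^sup>L lborel (f k) = pair_term m n k" for k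
    using f has_bochner_integral_iff by blast
  then show ?thesis2
    using sums_integral[OF int _ ints] norms by (simp add: eq)
qed

definition pairing :: "real \<Rightarrow> real \<Rightarrow> complex" where
  "pairing m n = (LINT x|lborel. gabor (m, n) x * of_real (dual x))"

lemma pairing_sums: "pair_term m n sums pairing m n"
  unfolding pairing_def by (rule gabor_dual_sums)

section \<open>Square integrability of the damped dual window\<close>

text \<open>The factor \<open>1 + cis (- 2 \<pi> x)\<close> vanishes exactly at the half-integers, where the dual window
  fails to decay.\<close>

lemma norm_one_plus_cis_le:
  assumes "\<bar>x\<bar> \<le> node k"
  shows "norm (1 + cis (- 2 * pi * x)) \<le> 2 * pi * (node k - \<bar>x\<bar>)"
proof -
  have "1 + cis (- 2 * pi * x) = 2 * cos (pi * x) * cis (- pi * x)"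
  proof -
    have "cos (2 * (pi * x)) = 2 * (cos (pi * x))\<^sup>2 - 1" "sin (2 * (pi * x)) = 2 * sin (pi * x) * cos (pi * x)"
      by (rule cos_double_cos, rule sin_double)
    then show ?thesis
      by (simp add: complex_eq_iff power2_eq_square mult_ac)
  qed
  then have "norm (1 + cis (- 2 * pi * x)) = 2 * \<bar>cos (pi * x)\<bar>"
    by (simp add: norm_mult)
  also have "cos (pi * x) = cos (pi * \<bar>x\<bar>)"
    by (cases "x \<ge> 0") auto
  \<comment> \<open>The cosine vanishes at \<open>pi * node k\<close>; expanding around this zero
    leaves the sine of the distance to the node.\<close>
  also have "pi * \<bar>x\<bar> = (pi * real k + pi / 2) - pi * (node k - \<bar>x\<bar>)"
    by (simp add: node_def algebra_simps)
  also have "cos \<dots> = sin (pi * real k + pi / 2) * sin (pi * (node k - \<bar>x\<bar>))"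
    by (subst cos_diff) (simp add: cos_add)
  also have "\<bar>\<dots>\<bar> \<le> 1 * \<bar>sin (pi * (node k - \<bar>x\<bar>))\<bar>"
    unfolding abs_mult by (intro mult_right_mono) auto
  also have "\<bar>sin (pi * (node k - \<bar>x\<bar>))\<bar> \<le> \<bar>pi * (node k - \<bar>x\<bar>)\<bar>"
    by (rule abs_sin_x_le_abs_x)
  also have "\<dots> = pi * (node k - \<bar>x\<bar>)"
    using assms by simp
  finally show ?thesis by simp
qed

text \<open>With \<open>u = (node k)\<^sup>2 - x\<^sup>2\<close>, the damping supplies the factor
  \<open>node k - \<bar>x\<bar>\<close>, which is \<open>u / (node k + \<bar>x\<bar>)\<close>. This
  gives the decay in \<open>x\<close>, and u exp (- pi u) is still geometric in the index, counted
  from the first node beyond \<open>\<bar>x\<bar>\<close>.\<close>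

lemma dual_term_damped_le:
  "\<bar>dual_term k x\<bar> * norm (1 + cis (- 2 * pi * x)) \<le>
     4 / (1/2 + \<bar>x\<bar>) * (if k \<ge> nat \<lceil>\<bar>x\<bar> - 1/2\<rceil> then exp (-1) ^ (k - nat \<lceil>\<bar>x\<bar> - 1/2\<rceil>) else 0)"
proof (cases "\<bar>x\<bar> \<le> node k")
  case False
  then have "dual_term k x = 0"
    by (auto simp: dual_term_def indicator_def abs_le_iff)
  then show ?thesis by simp
next
  case True
  \<comment> \<open>The least index with \<open>\<bar>x\<bar> \<le> node k0\<close>. The ceiling is
    never negative, so \<open>nat\<close> truncates nothing.\<close>
  define k0 where "k0 = nat \<lceil>\<bar>x\<bar> - 1/2\<rceil>"
  define u where "u = (node k - \<bar>x\<bar>) * (node k + \<bar>x\<bar>)"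
  have k: "k0 \<le> k"
    using True unfolding k0_def node_def by linarith
  then obtain j where j: "k = k0 + j"
    using le_Suc_ex by blast
  have xk0: "\<bar>x\<bar> \<le> node k0"
    unfolding k0_def node_def by linarith
  have u: "u = (node k)\<^sup>2 - x\<^sup>2"
    unfolding u_def by (simp add: algebra_simps power2_eq_square)
  have "real j \<le> (node k)\<^sup>2 - (node k0)\<^sup>2"
  proof -
    have "(node k)\<^sup>2 - (node k0)\<^sup>2 = real j + (real j)\<^sup>2 + 2 * real j * real k0"
      unfolding j node_def by (simp add: power2_eq_square algebra_simps)
    then show ?thesis by simp
  qed
  moreover have "x\<^sup>2 \<le> (node k0)\<^sup>2"
    using power_mono[OF xk0, of 2] by simp
  ultimately have uj: "real j \<le> u"
    unfolding u by simp
  then have u0: "u \<ge> 0" by (smt (verit) of_nat_0_le_iff)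
  have kx: "0 < node k + \<bar>x\<bar>" "1/2 + \<bar>x\<bar> \<le> node k + \<bar>x\<bar>"
    using node_pos[of k] by (simp_all add: node_def)
  have "\<bar>dual_term k x\<bar> = exp (- pi * u)"
    using True by (auto simp: dual_term_def abs_mult u algebra_simps abs_le_iff)
  then have "\<bar>dual_term k x\<bar> * norm (1 + cis (- 2 * pi * x)) \<le> exp (- pi * u) * (2 * pi * (node k - \<bar>x\<bar>))"
    using norm_one_plus_cis_le[OF True] by (simp add: mult_left_mono)
  also have "\<dots> = 2 * (pi * u * exp (- pi * u)) / (node k + \<bar>x\<bar>)"
    using kx(1) by (simp add: u_def field_simps)
  also have "\<dots> \<le> 2 * (2 * exp (- u)) / (node k + \<bar>x\<bar>)"
  proof -
    \<comment> \<open>The factor u is absorbed by lowering the rate from pi to 1: since 3 < pi < 4,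
      2 exp ((pi - 1) u) >= 2 + 4 u >= pi u.\<close>
    have "pi * u \<le> 4 * u" "3 * u \<le> pi * u"
      using pi_gt3 pi_less_4 u0 by (auto intro!: mult_right_mono)
    moreover have "1 + (pi * u - u) \<le> exp (pi * u - u)"
      by (rule exp_ge_add_one_self)
    ultimately have "pi * u \<le> 2 * exp (pi * u - u)"
      using u0 by linarith
    then have "pi * u * exp (- pi * u) \<le> 2 * exp (pi * u - u) * exp (- pi * u)"
      by (intro mult_right_mono) auto
    also have "\<dots> = 2 * exp (- u)"
      by (simp add: exp_add[symmetric])
    finally show ?thesis
      using kx by (intro divide_right_mono mult_left_mono) auto
  qed
  also have "\<dots> \<le> 4 * exp (- u) / (1/2 + \<bar>x\<bar>)"
    using kx by (intro frac_le) auto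
  also have "\<dots> \<le> 4 * exp (- real j) / (1/2 + \<bar>x\<bar>)"
    using uj by (intro divide_right_mono mult_left_mono) auto
  also have "exp (- real j) = exp (-1) ^ j"
    by (simp add: exp_of_nat_mult[symmetric])
  finally show ?thesis
    by (simp add: j flip: k0_def)
qed

lemma dual_damped_le:
  "norm (of_real (dual x) * (1 + cis (- 2 * pi * x))) \<le> 8 / (1/2 + \<bar>x\<bar>)"
proof -
  define k0 where "k0 = nat \<lceil>\<bar>x\<bar> - 1/2\<rceil>"
  define g where "g k = 4 / (1/2 + \<bar>x\<bar>) * (if k \<ge> k0 then exp (-1) ^ (k - k0) else 0)" for k
  let ?D = "norm (1 + cis (- 2 * pi * x))"
  \<comment> \<open>The geometric ratio is at most 1/2, so the series sums to at most 2 and the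
    constant 4 becomes 8.\<close>
  have exp1: "exp (-1 :: real) \<le> 1/2"
    using exp_ge_add_one_self[of "1::real"] by (simp add: exp_minus field_simps)
  have "(\<lambda>k. exp (-1 :: real) ^ k) sums (1 / (1 - exp (-1)))"
    by (rule geometric_sums) simp
  then have "(\<lambda>k. if k \<ge> k0 then exp (-1 :: real) ^ (k - k0) else 0) sums (1 / (1 - exp (-1)))"
    by (subst sums_iff_shift'[of _ k0, symmetric]) (simp_all)
  then have g: "g sums (4 / (1/2 + \<bar>x\<bar>) * (1 / (1 - exp (-1))))"
    unfolding g_def by (rule sums_mult)
  have "\<bar>dual x\<bar> * ?D \<le> (\<Sum>k. \<bar>dual_term k x\<bar>) * ?D"
    unfolding dual_def by (intro mult_right_mono summable_rabs summable_abs_dual_term) auto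
  also have "\<dots> = (\<Sum>k. \<bar>dual_term k x\<bar> * ?D)"
    by (rule suminf_mult2[OF summable_abs_dual_term])
  also have "\<dots> \<le> suminf g"
    by (intro suminf_le summable_mult2 summable_abs_dual_term sums_summable[OF g])
      (unfold g_def k0_def, rule dual_term_damped_le)
  also have "\<dots> = 4 / (1/2 + \<bar>x\<bar>) * (1 / (1 - exp (-1)))"
    using g by (rule sums_unique[symmetric])
  also have "\<dots> \<le> 4 / (1/2 + \<bar>x\<bar>) * 2"
    using exp1 by (intro mult_left_mono) (auto simp: field_simps)
  finally show ?thesis
    by (simp add: norm_mult)
qed

lemma dual_damped_square_integrable:
  "integrable lborel (\<lambda>x. (norm (of_real (dual x) * (1 + cis (- 2 * pi * x))))\<^sup>2)"
proof (rule Bochner_Integration.integrable_bound)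
  \<comment> \<open>256 is 4 * 8^2, because (1/2 + |x|)^2 >= (1 + x^2) / 4.\<close>
  show "integrable lborel (\<lambda>x::real. 256 * inverse (1 + x\<^sup>2))"
    using integrable_inverse_1_plus_square by (simp add: set_integrable_def)
  show "(\<lambda>x. (norm (of_real (dual x) * (1 + cis (- 2 * pi * x))))\<^sup>2) \<in> borel_measurable lborel"
    unfolding cis_conv_exp by measurable
  have "(norm (of_real (dual x) * (1 + cis (- 2 * pi * x))))\<^sup>2 \<le> 256 * inverse (1 + x\<^sup>2)" for x
  proof -
    have "(norm (of_real (dual x) * (1 + cis (- 2 * pi * x))))\<^sup>2 \<le> (8 / (1/2 + \<bar>x\<bar>))\<^sup>2"
      by (intro power_mono dual_damped_le) auto
    also have "\<dots> = 64 / (1/4 + \<bar>x\<bar> + x\<^sup>2)"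
      by (simp add: power_divide power2_eq_square algebra_simps)
    also have "\<dots> \<le> 64 / ((1 + x\<^sup>2) / 4)"
      by (intro divide_left_mono) (auto simp: field_simps add_pos_nonneg intro!: mult_pos_pos add_pos_nonneg)
    finally show ?thesis by (simp add: field_simps)
  qed
  then show "AE x in lborel. norm ((norm (of_real (dual x) * (1 + cis (- 2 * pi * x))))\<^sup>2) \<le> norm (256 * inverse (1 + x\<^sup>2))"
    by (auto simp: abs_of_nonneg)
qed

subsection \<open>Pairing values at lattice and half-lattice points\<close>

text \<open>Completing the square turns the prefactors into Gaussians sampled at
  \<open>node k - m\<close> and \<open>node k + m\<close>. These are the two halves of one theta
  series over all integers, with its origin moved by \<open>m\<close>.\<close>

lemma pair_term_eq:
  assumes "\<not> (m = 0 \<and> n = 0)"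
  shows "pair_term m n k = of_real (2 powr (1/4)) / (2 * pi * Complex m n) *
    ((-1) ^ k * (of_real (exp (- pi * (node k - m)\<^sup>2)) * cis (2 * pi * n * node k)
               - of_real (exp (- pi * (node k + m)\<^sup>2)) * cis (- (2 * pi * n * node k))))"
proof -
  have e1: "exp (2 * pi * Complex m n * node k) = of_real (exp (2 * pi * m * node k)) * cis (2 * pi * n * node k)"
    by (subst exp_eq_polar) (simp add: mult_ac)
  have e2: "exp (- (2 * pi * Complex m n * node k)) = of_real (exp (- (2 * pi * m * node k))) * cis (- (2 * pi * n * node k))"
    by (subst exp_eq_polar) (simp add: mult_ac)
  have r1: "exp (- pi * (node k - m)\<^sup>2) = exp (- pi * m\<^sup>2) * exp (- pi * (node k)\<^sup>2) * exp (2 * pi * m * node k)"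
    unfolding exp_add[symmetric] by (rule arg_cong[where f=exp]) (simp add: power2_eq_square algebra_simps)
  have r2: "exp (- pi * (node k + m)\<^sup>2) = exp (- pi * m\<^sup>2) * exp (- pi * (node k)\<^sup>2) * exp (- (2 * pi * m * node k))"
    unfolding exp_add[symmetric] by (rule arg_cong[where f=exp]) (simp add: power2_eq_square algebra_simps)
  show ?thesis
    unfolding pair_term_def e1 e2 if_not_P[OF assms]
    unfolding r1 r2 of_real_mult
    by (simp add: algebra_simps diff_divide_distrib)
qed

text \<open>Moving the origin by one transfers a single term from one half of the two-sided series
  to the other, so the total does not change.\<close>

lemma two_sided_sums_shift:
  fixes f :: "int \<Rightarrow> 'a::real_normed_vector"
  assumes "(\<lambda>k. f (int k)) sums u" "(\<lambda>k. f (-1 - int k)) sums v"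
  shows "(\<lambda>k. f (int k + m) + f (-1 - int k + m)) sums (u + v)"
proof -
  \<comment> \<open>The half sums change with \<open>m\<close>; only their convergence and their
    total are invariant, hence the existential.\<close>
  define Q where "Q m \<longleftrightarrow> (\<exists>u' v'. (\<lambda>k. f (int k + m)) sums u' \<and> (\<lambda>k. f (-1 - int k + m)) sums v' \<and> u' + v' = u + v)" for m
  have a: "(\<lambda>k. f (int k + (m + 1))) sums w \<longleftrightarrow> (\<lambda>k. f (int k + m)) sums (w + f m)" for m w
    using sums_Suc_iff[of "\<lambda>k. f (int k + m)" w] by (simp add: add_ac)
  have b: "(\<lambda>k. f (-1 - int k + m)) sums w \<longleftrightarrow> (\<lambda>k. f (-1 - int k + (m + 1))) sums (w + f m)" for m w
    using sums_Suc_iff[of "\<lambda>k. f (-1 - int k + (m + 1))" w] by (simp add: algebra_simps)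
  have "Q (m + 1) \<longleftrightarrow> Q m" for m
  proof
    assume "Q (m + 1)"
    then obtain u' v' where "(\<lambda>k. f (int k + (m + 1))) sums u'" "(\<lambda>k. f (-1 - int k + (m + 1))) sums v'" "u' + v' = u + v"
      unfolding Q_def by blast
    then show "Q m"
      unfolding Q_def using a[of m u'] b[of m "v' - f m"] by (intro exI[of _ "u' + f m"] exI[of _ "v' - f m"]) auto
  next
    assume "Q m"
    then obtain u' v' where "(\<lambda>k. f (int k + m)) sums u'" "(\<lambda>k. f (-1 - int k + m)) sums v'" "u' + v' = u + v"
      unfolding Q_def by blast
    then show "Q (m + 1)"
      unfolding Q_def using a[of m "u' - f m"] b[of m v'] by (intro exI[of _ "u' - f m"] exI[of _ "v' + f m"]) auto
  qed
  note step = this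
  have "Q 0"
    unfolding Q_def using assms by (intro exI[of _ u] exI[of _ v]) simp
  then have "Q m"
  proof (induction m rule: int_induct[where k = 0])
    case (step2 i)
    then show ?case using step[of "i - 1"] by simp
  qed (use step in auto)
  then show ?thesis
    unfolding Q_def using sums_add by metis
qed

lemma cis_pi_int: "cis (- (pi * of_int N)) = cis (pi * of_int N)"
proof -
  have "cis (pi * of_int N) = cis (- (pi * of_int N)) * cis (2 * pi * of_int N)"
    by (simp add: cis_mult algebra_simps)
  then show ?thesis by (simp add: cis_multiple_2pi)
qed

lemma summable_gauss: "summable (\<lambda>k. exp (- pi * (node k)\<^sup>2))"
  using summable_exp_node[of 0] by simp

text \<open>Both phases in \<open>pair_term_eq\<close> equal cis (pi N), so the pairing is a
  multiple of the sum over all integers j of (-1)^j exp (- pi (j + 1/2)^2). The reflection j -> -1 -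
  j negates the summand, and the total is zero.\<close>

lemma pairing_int:
  assumes "\<not> (M = 0 \<and> N = 0)"
  shows "pairing (of_int M) (of_int N) = 0"
proof -
  define f where "f j = (-1) powi j * exp (- pi * (of_int j + 1/2)\<^sup>2)" for j :: int
  \<comment> \<open>The factor \<open>(-1) powi M\<close> undoes the sign that the shifted index
    \<open>int k - M\<close> brings into \<open>f\<close>.\<close>
  define C where "C = of_real (2 powr (1/4)) / (2 * pi * Complex (of_int M) (of_int N)) * cis (pi * of_int N) * (-1) powi M"
  have "summable (\<lambda>k. f (int k))"
    by (rule summable_rabs_cancel) (use summable_gauss in \<open>simp add: f_def abs_mult power_abs node_def\<close>)
  then obtain u where u: "(\<lambda>k. f (int k)) sums u"
    by (auto simp: summable_def)
  have f_refl: "f (-1 - j) = - f j" for j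
  proof -
    have "(-1 :: real) powi (-1 - j) = - ((-1) powi j)"
      by (simp add: power_int_minus_left)
    moreover have "(of_int (-1 - j) + 1/2)\<^sup>2 = (of_int j + 1/2 :: real)\<^sup>2"
      by (simp add: power2_eq_square algebra_simps)
    ultimately show ?thesis unfolding f_def by simp
  qed
  have "(\<lambda>k. f (-1 - int k)) sums (- u)"
    unfolding f_refl using u by (rule sums_minus)
  from two_sided_sums_shift[OF u this, of "- M"]
  have A: "(\<lambda>k. C * of_real (f (int k - M) + f (-1 - int k - M))) sums (C * of_real 0)"
    by (intro sums_mult sums_of_real) simp
  have B: "pair_term (of_int M) (of_int N) k = C * of_real (f (int k - M) + f (-1 - int k - M))" for k
  proof -
    have c1: "cis (2 * pi * of_int N * node k) = cis (pi * of_int N)"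
    proof -
      have "cis (2 * pi * of_int N * node k) = cis (2 * pi * of_int (N * int k)) * cis (pi * of_int N)"
        by (simp add: cis_mult node_def algebra_simps)
      then show ?thesis by (simp add: cis_multiple_2pi del: of_int_mult)
    qed
    have c2: "cis (- (2 * pi * of_int N * node k)) = cis (pi * of_int N)"
      using arg_cong[OF c1, of cnj] by (simp add: cis_cnj cis_pi_int)
    have s: "(-1 :: real) powi (int k - M) = (-1) ^ k * (-1) powi M" "(-1 :: real) powi (-1 - int k - M) = - ((-1) ^ k * (-1) powi M)"
      by (auto simp: power_int_minus_left)
    have n1: "of_int (int k - M) + 1/2 = node k - of_int M"
      by (simp add: node_def)
    have n2: "(of_int (-1 - int k - M) + 1/2)\<^sup>2 = (node k + of_int M)\<^sup>2"
      by (simp add: node_def power2_eq_square algebra_simps)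
    have ss: "(-1 :: complex) powi M * (-1) powi M = 1"
      by (simp add: power_int_minus_left)
    have "C * of_real (f (int k - M) + f (-1 - int k - M)) =
        of_real (2 powr (1/4)) / (2 * pi * Complex (of_int M) (of_int N)) * cis (pi * of_int N) * ((-1) powi M * (-1) powi M) *
          ((-1) ^ k * (of_real (exp (- pi * (node k - of_int M)\<^sup>2)) - of_real (exp (- pi * (node k + of_int M)\<^sup>2))))"
      unfolding C_def f_def s n1 n2 by (simp add: algebra_simps)
    also have "\<dots> = pair_term (of_int M) (of_int N) k"
      unfolding ss using assms by (subst pair_term_eq) (simp, unfold c1 c2, simp add: algebra_simps)
    finally show ?thesis by simp
  qed
  have "pair_term (of_int M) (of_int N) sums 0"
    using sums_cong[THEN iffD2, OF B A] by simp
  then show ?thesis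
    using pairing_sums sums_unique2 by blast
qed

text \<open>For half-odd \<open>n\<close> the phases are plus and minus i (-1)^k cis (pi N): the
  sign cancels the alternation and the difference becomes a sum. For half-odd \<open>m\<close> the
  Gaussians are sampled at integers, so what remains is the positive theta series of exp (- pi j^2),
  and only the prefactor depends on the point.\<close>

lemma pairing_half_int:
  obtains \<kappa> where "\<kappa> > 0"
    "\<And>M N. norm (pairing (of_int M + 1/2) (of_int N + 1/2)) = \<kappa> / norm (Complex (of_int M + 1/2) (of_int N + 1/2))"
proof -
  define f where "f j = exp (- pi * (of_int j)\<^sup>2)" for j :: int
  have sum2: "summable (\<lambda>k. f (-1 - int k))" and sum1: "summable (\<lambda>k. f (int k))"
  proof -
    show "summable (\<lambda>k. f (-1 - int k))"
    proof (rule summable_comparison_test'[OF summable_gauss])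
      show "norm (f (-1 - int k)) \<le> exp (- pi * (node k)\<^sup>2)" for k
      proof -
        have "(node k)\<^sup>2 \<le> (of_int (-1 - int k))\<^sup>2"
          by (simp add: node_def power2_eq_square algebra_simps)
        then show ?thesis by (simp add: f_def)
      qed
    qed
    \<comment> \<open>\<open>f\<close> is even, so the negative half is the other half without its
      term at 0.\<close>
    moreover have "f (-1 - int k) = f (int (Suc k))" for k
      by (simp add: f_def power2_eq_square algebra_simps)
    ultimately show "summable (\<lambda>k. f (int k))"
      using summable_Suc_iff[of "\<lambda>k. f (int k)"] by simp
  qed
  define u v where "u = (\<Sum>k. f (int k))" and "v = (\<Sum>k. f (-1 - int k))"
  have u: "(\<lambda>k. f (int k)) sums u" and v: "(\<lambda>k. f (-1 - int k)) sums v"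
    unfolding u_def v_def using sum1 sum2 by (auto intro: summable_sums)
  have "u > 0" "v > 0"
    unfolding u_def v_def using sum1 sum2 by (auto intro!: suminf_pos simp: f_def)
  show ?thesis
  proof (rule that)
    show "2 powr (1/4) / (2 * pi) * (u + v) > 0"
      using \<open>u > 0\<close> \<open>v > 0\<close> by simp
    fix M N :: int
    let ?m = "of_int M + 1/2 :: real" and ?n = "of_int N + 1/2 :: real"
    define C where "C = of_real (2 powr (1/4)) / (2 * pi * Complex ?m ?n) * cis (pi * of_int N) * \<i>"
    have A: "(\<lambda>k. C * of_real (f (int k + - M) + f (-1 - int k + - M))) sums (C * of_real (u + v))"
      by (intro sums_mult sums_of_real two_sided_sums_shift u v)
    have B: "pair_term ?m ?n k = C * of_real (f (int k + - M) + f (-1 - int k + - M))" for k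
    proof -
      have c1: "cis (2 * pi * ?n * node k) = cis (pi * of_int N) * (-1) ^ k * \<i>"
      proof -
        have "2 * pi * ?n * node k = 2 * pi * of_int (N * int k) + pi * of_int N + of_nat k * pi + pi / 2"
          by (simp add: node_def algebra_simps add_divide_distrib)
        then have "cis (2 * pi * ?n * node k) =
            cis (2 * pi * of_int (N * int k)) * cis (pi * of_int N) * cis (of_nat k * pi) * cis (pi / 2)"
          by (simp only: cis_mult)
        moreover have "cis (of_nat k * pi) = (-1) ^ k"
          using Complex.DeMoivre[of pi k] unfolding cis_pi by (rule sym)
        moreover have "cis (2 * pi * of_int (N * int k)) = 1"
          by (intro cis_multiple_2pi) auto
        ultimately show ?thesis by simp
      qed
      have c2: "cis (- (2 * pi * ?n * node k)) = - (cis (pi * of_int N) * (-1) ^ k * \<i>)"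
        using arg_cong[OF c1, of cnj] by (simp add: cis_cnj cis_pi_int)
      have n1: "of_int (int k + - M) = node k - ?m"
        by (simp add: node_def)
      have n2: "(of_int (-1 - int k + - M))\<^sup>2 = (node k + ?m)\<^sup>2"
        by (simp add: node_def power2_eq_square algebra_simps)
      have ss: "(-1) ^ k * (-1) ^ k = (1 :: complex)"
        by (simp add: power_mult_distrib[symmetric])
      have "\<not> (?m = 0 \<and> ?n = 0)"
      proof -
        have "2 * M + 1 \<noteq> 0" by presburger
        then have "real_of_int (2 * M + 1) \<noteq> 0" by (simp only: of_int_eq_0_iff not_False_eq_True)
        then show ?thesis by simp
      qed
      then have "pair_term ?m ?n k = of_real (2 powr (1/4)) / (2 * pi * Complex ?m ?n) *
        (((-1) ^ k * (-1) ^ k) * (of_real (exp (- pi * (node k - ?m)\<^sup>2)) + of_real (exp (- pi * (node k + ?m)\<^sup>2))) * cis (pi * of_int N) * \<i>)"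
        by (subst pair_term_eq) (assumption, unfold c1 c2, simp add: algebra_simps)
      also have "\<dots> = C * of_real (f (int k + - M) + f (-1 - int k + - M))"
        unfolding ss C_def f_def n1 n2 by (simp add: algebra_simps add_divide_distrib)
      finally show ?thesis .
    qed
    have "pair_term ?m ?n sums (C * of_real (u + v))"
      by (rule sums_cong[THEN iffD2, OF B A])
    then have "pairing ?m ?n = C * of_real (u + v)"
      using pairing_sums sums_unique2 by blast
    then have "norm (pairing ?m ?n) = norm C * \<bar>u + v\<bar>"
      by (simp only: norm_mult norm_of_real)
    also have "norm C = 2 powr (1/4) / (2 * pi) / norm (Complex ?m ?n)"
      unfolding C_def by (simp add: norm_mult norm_divide)
    finally show "norm (pairing ?m ?n) = 2 powr (1/4) / (2 * pi) * (u + v) / norm (Complex ?m ?n)"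
      using \<open>u > 0\<close> \<open>v > 0\<close> by simp
  qed
qed

text \<open>The series alternates with positive, strictly decreasing terms \<open>a k\<close>, so by
  Leibniz its sum is at least \<open>a 0 - a 1\<close>.\<close>

lemma pairing_0_0_nonzero: "pairing 0 0 \<noteq> 0"
proof -
  define a where "a k = 2 * node k * exp (- pi * (node k)\<^sup>2)" for k
  have a_sum: "summable a"
    unfolding a_def using summable_node_exp_node[of 0] by simp
  have a_pos: "a k > 0" for k
    unfolding a_def using node_pos by simp
  have a_dec: "a (Suc k) < a k" for k
  proof -
    have "exp (- pi * (node (Suc k))\<^sup>2) = exp (- pi * (node k)\<^sup>2) * exp (- (2 * pi * (real k + 1)))"
      unfolding exp_add[symmetric] by (rule arg_cong[where f=exp]) (simp add: node_def power2_eq_square algebra_simps)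
    also have "\<dots> \<le> exp (- pi * (node k)\<^sup>2) * exp (- 6)"
    proof -
      \<comment> \<open>Consecutive squared nodes differ by 2 (k + 1), so the Gaussian drops by a
        factor of at most exp (-6) <= 1/7, while the node grows at most threefold.\<close>
      have "6 * 1 \<le> 2 * pi * (real k + 1)"
        using pi_gt3 by (intro mult_mono) auto
      then show ?thesis by (intro mult_left_mono) auto
    qed
    finally have "a (Suc k) \<le> 2 * node (Suc k) * (exp (- pi * (node k)\<^sup>2) * exp (- 6))"
      unfolding a_def using node_pos[of "Suc k"] by (intro mult_left_mono) auto
    also have "\<dots> = (node (Suc k) * exp (- 6)) * (2 * exp (- pi * (node k)\<^sup>2))"
      by simp
    also have "\<dots> < node k * (2 * exp (- pi * (node k)\<^sup>2))"
    proof -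
      have "7 \<le> exp (6 :: real)"
        using exp_ge_add_one_self[of "6::real"] by simp
      then have "exp (- 6 :: real) \<le> 1 / 7"
        by (simp add: exp_minus field_simps)
      then have "node (Suc k) * exp (- 6) \<le> node (Suc k) * (1 / 7)"
        using node_pos[of "Suc k"] by (intro mult_left_mono) auto
      also have "\<dots> < node k"
        by (simp add: node_def)
      finally show ?thesis by (intro mult_strict_right_mono) auto
    qed
    finally show ?thesis by (simp add: a_def mult_ac)
  qed
  have "0 < a 0 - a 1"
    using a_dec[of 0] by simp
  also have "a 0 - a 1 = (\<Sum>i<2*1. (-1) ^ i * a i)"
    by (simp add: numeral_2_eq_2)
  also have "\<dots> \<le> (\<Sum>i. (-1) ^ i * a i)"
    using a_pos a_dec by (intro summable_Leibniz'(2) summable_LIMSEQ_zero a_sum) (auto intro: less_imp_le)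
  finally have pos: "(\<Sum>i. (-1) ^ i * a i) > 0" .
  have "summable (\<lambda>i. (-1) ^ i * a i)"
    using a_pos a_dec by (intro summable_Leibniz'(1) summable_LIMSEQ_zero a_sum) (auto intro: less_imp_le)
  then have A: "(\<lambda>k. of_real (2 powr (1/4)) * complex_of_real ((-1) ^ k * a k)) sums
      (of_real (2 powr (1/4)) * of_real (\<Sum>i. (-1) ^ i * a i))"
    by (intro sums_mult sums_of_real summable_sums)
  have B: "pair_term 0 0 k = of_real (2 powr (1/4)) * complex_of_real ((-1) ^ k * a k)" for k
    by (simp add: pair_term_def a_def)
  have "pairing 0 0 = of_real (2 powr (1/4)) * of_real (\<Sum>i. (-1) ^ i * a i)"
    using pairing_sums sums_cong[THEN iffD2, OF B A] by (rule sums_unique2)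
  then show ?thesis using pos by simp
qed

subsection \<open>Square-integrable functions\<close>

lemma L2_I: "f \<in> borel_measurable borel \<Longrightarrow> integrable lborel (\<lambda>x. (cmod (f x))\<^sup>2) \<Longrightarrow> f \<in> L2"
  by (simp add: L2_def)

lemma L2_measurable: "f \<in> L2 \<Longrightarrow> f \<in> borel_measurable borel"
  and L2_integrable: "f \<in> L2 \<Longrightarrow> integrable lborel (\<lambda>x. (cmod (f x))\<^sup>2)"
  by (simp_all add: L2_def)

lemma L2_diff:
  assumes "f \<in> L2" "g \<in> L2"
  shows "(\<lambda>x. f x - g x) \<in> L2"
proof (rule L2_I)
  note [measurable] = L2_measurable[OF assms(1)] L2_measurable[OF assms(2)]
  show "(\<lambda>x. f x - g x) \<in> borel_measurable borel"
    by measurable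
  show "integrable lborel (\<lambda>x. (cmod (f x - g x))\<^sup>2)"
  proof (rule Bochner_Integration.integrable_bound)
    show "integrable lborel (\<lambda>x. 2 * (cmod (f x))\<^sup>2 + 2 * (cmod (g x))\<^sup>2)"
      using assms[THEN L2_integrable] by auto
    have "(cmod (f x - g x))\<^sup>2 \<le> 2 * (cmod (f x))\<^sup>2 + 2 * (cmod (g x))\<^sup>2" for x
    proof -
      have "(cmod (f x - g x))\<^sup>2 \<le> (cmod (f x) + cmod (g x))\<^sup>2"
        by (intro power_mono norm_triangle_ineq4) auto
      moreover have "0 \<le> (cmod (f x) - cmod (g x))\<^sup>2"
        by simp
      ultimately show ?thesis
        by (simp add: power2_eq_square algebra_simps)
    qed
    then show "AE x in lborel. norm ((cmod (f x - g x))\<^sup>2) \<le> norm (2 * (cmod (f x))\<^sup>2 + 2 * (cmod (g x))\<^sup>2)"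
      by simp
  qed measurable
qed

lemma L2_sum:
  assumes "finite F" "\<And>l. l \<in> F \<Longrightarrow> f l \<in> L2"
  shows "(\<lambda>x. \<Sum>l\<in>F. f l x) \<in> L2"
  using assms
proof (induction F rule: finite_induct)
  case empty
  then show ?case by (simp add: L2_def)
next
  case (insert a F)
  have zero: "(\<lambda>x. 0) \<in> L2"
    by (simp add: L2_def)
  \<comment> \<open>A sum is written as a double difference so that \<open>L2_diff\<close> covers
    it.\<close>
  have "(\<lambda>x. f a x - (0 - (\<Sum>l\<in>F. f l x))) \<in> L2"
    using insert by (intro L2_diff zero) auto
  then show ?case using insert by simp
qed

lemma L2_mult_integrable:
  assumes "f \<in> L2" "g \<in> L2"
  shows "integrable lborel (\<lambda>x. f x * g x)"
proof (rule Bochner_Integration.integrable_bound)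
  note [measurable] = L2_measurable[OF assms(1)] L2_measurable[OF assms(2)]
  show "integrable lborel (\<lambda>x. (cmod (f x))\<^sup>2 + (cmod (g x))\<^sup>2)"
    using assms[THEN L2_integrable] by auto
  have "cmod (f x) * cmod (g x) \<le> (cmod (f x))\<^sup>2 + (cmod (g x))\<^sup>2" for x
  proof -
    have "2 * (cmod (f x) * cmod (g x)) \<le> (cmod (f x))\<^sup>2 + (cmod (g x))\<^sup>2"
      using sum_squares_bound[of "cmod (f x)" "cmod (g x)"] by (simp add: mult.assoc)
    moreover have "0 \<le> cmod (f x) * cmod (g x)" by simp
    ultimately show ?thesis by linarith
  qed
  then show "AE x in lborel. norm (f x * g x) \<le> norm ((cmod (f x))\<^sup>2 + (cmod (g x))\<^sup>2)"
    by (simp add: norm_mult)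
  show "(\<lambda>x. f x * g x) \<in> borel_measurable lborel"
    by simp
qed

lemma L2_norm_nonneg: "L2_norm f \<ge> 0"
  by (simp add: L2_norm_def)

text \<open>A weighted arithmetic-geometric mean inequality is integrated, and the weight
  \<open>t\<close> is then optimised.\<close>

lemma L2_Cauchy_Schwarz:
  assumes "f \<in> L2" "g \<in> L2"
  shows "norm (LINT x|lborel. f x * g x) \<le> L2_norm f * L2_norm g"
proof -
  let ?a = "L2_norm f" and ?b = "L2_norm g" and ?n = "norm (LINT x|lborel. f x * g x)"
  have sq: "(L2_norm h)\<^sup>2 = (LINT x|lborel. (cmod (h x))\<^sup>2)" for h
    by (simp add: L2_norm_def)
  have weighted: "?n \<le> (t * ?a\<^sup>2 + ?b\<^sup>2 / t) / 2" if "t > 0" for t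
  proof -
    have "?n \<le> (LINT x|lborel. norm (f x * g x))"
      by (rule integral_norm_bound)
    also have "\<dots> \<le> (LINT x|lborel. (t * (cmod (f x))\<^sup>2 + (cmod (g x))\<^sup>2 / t) / 2)"
    proof (rule integral_mono)
      show "integrable lborel (\<lambda>x. norm (f x * g x))"
        using assms by (intro integrable_norm L2_mult_integrable)
      show "integrable lborel (\<lambda>x. (t * (cmod (f x))\<^sup>2 + (cmod (g x))\<^sup>2 / t) / 2)"
        using assms[THEN L2_integrable] by auto
      fix x
      have "0 \<le> (t * cmod (f x) - cmod (g x))\<^sup>2 / t"
        using that by simp
      then show "norm (f x * g x) \<le> (t * (cmod (f x))\<^sup>2 + (cmod (g x))\<^sup>2 / t) / 2"
        using that by (simp add: norm_mult power2_eq_square field_simps)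
    qed
    also have "\<dots> = (t * ?a\<^sup>2 + ?b\<^sup>2 / t) / 2"
      unfolding sq using assms[THEN L2_integrable] by simp
    finally show ?thesis .
  qed
  \<comment> \<open>The ideal weight is \<open>?b / ?a\<close>; adding \<open>e\<close> keeps it
    defined and positive when a norm vanishes, and \<open>e\<close> tends to 0 at the end.\<close>
  have "?n \<le> (?a + e) * (?b + e)" if "e > 0" for e
  proof -
    have pos: "?a + e > 0" "?b + e > 0"
      using that L2_norm_nonneg[of f] L2_norm_nonneg[of g] by auto
    have "?n \<le> ((?b + e) / (?a + e) * ?a\<^sup>2 + ?b\<^sup>2 / ((?b + e) / (?a + e))) / 2"
      using pos by (intro weighted) simp
    also have "\<dots> \<le> ((?b + e) / (?a + e) * (?a + e)\<^sup>2 + (?b + e)\<^sup>2 / ((?b + e) / (?a + e))) / 2"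
      using pos that L2_norm_nonneg[of f] L2_norm_nonneg[of g]
      by (intro divide_right_mono add_mono mult_left_mono power_mono) auto
    also have "\<dots> = (?a + e) * (?b + e)"
      using pos by (simp add: power2_eq_square)
    finally show ?thesis .
  qed
  then have "eventually (\<lambda>e. ?n \<le> (?a + e) * (?b + e)) (at_right 0)"
    by (auto simp: eventually_at_right_less intro: eventually_mono[OF eventually_at_right_less])
  moreover have "((\<lambda>e. (?a + e) * (?b + e)) \<longlongrightarrow> (?a + 0) * (?b + 0)) (at_right 0)"
    by (intro tendsto_intros)
  ultimately show ?thesis
    using tendsto_lowerbound[of _ _ "at_right (0::real)"] by fastforce
qed

subsection \<open>Shifted dual windows and the coefficients\<close>

text \<open>The pairings are bilinear, without conjugation, so the frequency carries the minus
  sign.\<close>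

definition dual_at :: "real \<Rightarrow> real \<Rightarrow> real \<Rightarrow> complex" where
  "dual_at p q x = of_real (dual (x - p)) * cis (- 2 * pi * q * x)"

text \<open>Translation by \<open>p\<close> reduces the integral to \<open>pairing\<close>; the
  phase arises because the modulations are taken at \<open>x\<close> and not at
  \<open>x - p\<close>.\<close>

lemma gabor_dual_at:
  "has_bochner_integral lborel (\<lambda>x. gabor (m, n) x * dual_at p q x)
     (cis (2 * pi * (n - q) * p) * pairing (m - p) (n - q))"
proof -
  have "has_bochner_integral lborel (\<lambda>x. gabor (m - p, n - q) x * of_real (dual x)) (pairing (m - p) (n - q))"
    unfolding pairing_def using gabor_dual_integrable by (rule has_bochner_integral_integrable)
  then have "has_bochner_integral lborel (\<lambda>x. gabor (m - p, n - q) (x - p) * of_real (dual (x - p))) (pairing (m - p) (n - q))"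
    using lborel_has_bochner_integral_real_affine_iff[of 1 "\<lambda>x. gabor (m - p, n - q) x * of_real (dual x)" _ "- p"] by simp
  then have "has_bochner_integral lborel
      (\<lambda>x. cis (2 * pi * (n - q) * p) * (gabor (m - p, n - q) (x - p) * of_real (dual (x - p))))
      (cis (2 * pi * (n - q) * p) * pairing (m - p) (n - q))"
    by (rule has_bochner_integral_mult_right)
  moreover have "cis (2 * pi * (n - q) * p) * (gabor (m - p, n - q) (x - p) * of_real (dual (x - p))) =
      gabor (m, n) x * dual_at p q x" for x
  proof -
    have "cis (2 * pi * (n - q) * p) * cis (2 * pi * (n - q) * (x - p)) = cis (2 * pi * n * x) * cis (- 2 * pi * q * x)"
      unfolding cis_mult by (rule arg_cong[where f = cis]) (simp add: algebra_simps)
    then show ?thesis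
      unfolding gabor_eq dual_at_def by (simp add: mult_ac)
  qed
  ultimately show ?thesis by simp
qed

definition dual_pair :: "real \<Rightarrow> real \<Rightarrow> real \<Rightarrow> complex" where
  "dual_pair p q x = dual_at p q x + dual_at p (q + 1) x"

lemma gabor_dual_pair:
  "has_bochner_integral lborel (\<lambda>x. gabor (m, n) x * dual_pair p q x)
     (cis (2 * pi * (n - q) * p) * pairing (m - p) (n - q)
      + cis (2 * pi * (n - (q + 1)) * p) * pairing (m - p) (n - (q + 1)))"
  unfolding dual_pair_def distrib_left by (intro has_bochner_integral_add gabor_dual_at)

text \<open>The damping factor has period 1, so for an integer shift the modulus is a translate of
  that of the damped window.\<close>

lemma dual_pair_L2: "dual_pair (of_int p) q \<in> L2"
proof (rule L2_I)
  show "dual_pair (of_int p) q \<in> borel_measurable borel"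
    unfolding dual_pair_def[abs_def] dual_at_def cis_conv_exp by measurable
  let ?h = "\<lambda>x. (norm (of_real (dual x) * (1 + cis (- 2 * pi * x))))\<^sup>2"
  have "integrable lborel (\<lambda>x. ?h (x - of_int p))"
    using dual_damped_square_integrable lborel_integrable_real_affine_iff[of 1 ?h "- of_int p"] by simp
  moreover have "(cmod (dual_pair (of_int p) q x))\<^sup>2 = ?h (x - of_int p)" for x
  proof -
    have "cis (- 2 * pi * (x - of_int p)) = cis (- 2 * pi * x) * cis (2 * pi * of_int p)"
      by (simp add: cis_mult algebra_simps)
    then have e1: "cis (- 2 * pi * (x - of_int p)) = cis (- 2 * pi * x)"
      by (simp add: cis_multiple_2pi)
    have e2: "cis (- 2 * pi * (q + 1) * x) = cis (- 2 * pi * q * x) * cis (- 2 * pi * x)"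
      by (simp add: cis_mult algebra_simps)
    have "dual_pair (of_int p) q x =
        cis (- 2 * pi * q * x) * (of_real (dual (x - of_int p)) * (1 + cis (- 2 * pi * (x - of_int p))))"
      unfolding dual_pair_def dual_at_def e1 e2 by (simp add: algebra_simps)
    then show ?thesis
      by (simp only: norm_mult norm_cis mult_1_left)
  qed
  ultimately show "integrable lborel (\<lambda>x. (cmod (dual_pair (of_int p) q x))\<^sup>2)"
    by simp
qed

text \<open>Biorthogonality: \<open>pairing_int\<close> removes every lattice point except the two
  where the pairing is taken at the origin, and there the phase is 1.\<close>

lemma gabor_dual_pair_lattice:
  "has_bochner_integral lborel (\<lambda>x. gabor (of_int m, of_int n) x * dual_pair (of_int p) (of_int q) x)
     (if m = p \<and> (n = q \<or> n = q + 1) then pairing 0 0 else 0)"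
proof -
  have pr: "cis (2 * pi * (of_int n - of_int q') * of_int p) * pairing (of_int m - of_int p) (of_int n - of_int q') =
      (if m = p \<and> n = q' then pairing 0 0 else 0)" for q'
  proof (cases "m = p \<and> n = q'")
    case False
    then show ?thesis
      using pairing_int[of "m - p" "n - q'"] by auto
  qed auto
  show ?thesis
    using gabor_dual_pair[of "of_int m" "of_int n" "of_int p" "of_int q"] pr[of q] pr[of "q + 1"]
    by (auto split: if_splits)
qed

definition sharp_pairing :: "int \<Rightarrow> int \<Rightarrow> complex" where
  "sharp_pairing p q = cis (2 * pi * (1/2 - of_int q) * of_int p) * pairing (1/2 - of_int p) (1/2 - of_int q)"

text \<open>The relation is paired with the square-integrable \<open>dual_pair\<close>, so
  Cauchy-Schwarz carries the pairing through the L2 limit.\<close>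

lemma coefficient_relation:
  assumes "has_sum_L2 (\<lambda>l x. c l * gabor l x) s Lambda"
    and "AE x in lborel. b * gabor sharp x + s x = 0"
  shows "pairing 0 0 * (c (of_int p, of_int q) + c (of_int p, of_int (q + 1))) +
    b * (sharp_pairing p q + sharp_pairing p (q + 1)) = 0"
proof -
  let ?h = "dual_pair (of_int p) (of_int q)"
  let ?l0 = "(of_int p, of_int q) :: real \<times> real" and ?l1 = "(of_int p, of_int (q + 1)) :: real \<times> real"
  \<comment> \<open>\<open>X\<close> is the gap between the pairing expected of the series and the
    actual pairing of \<open>s\<close>; it is shown to be zero.\<close>
  define X where "X = pairing 0 0 * (c ?l0 + c ?l1) - (LINT x|lborel. s x * ?h x)"
  have terms: "\<And>l. l \<in> Lambda \<Longrightarrow> (\<lambda>x. c l * gabor l x) \<in> L2" and s: "s \<in> L2"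
    and lim: "((\<lambda>F. L2_norm (\<lambda>x. (\<Sum>l\<in>F. c l * gabor l x) - s x)) \<longlongrightarrow> 0) (finite_subsets_at_top Lambda)"
    using assms(1) unfolding has_sum_L2_def by auto
  note h = dual_pair_L2[of p "of_int q"]
  have in_Lambda: "?l0 \<in> Lambda" "?l1 \<in> Lambda"
    unfolding Lambda_def by auto
  \<comment> \<open>Once \<open>F\<close> contains both surviving points, the partial sum already
    pairs to the final value, and \<open>X\<close> is the pairing of the remainder alone.\<close>
  have bound: "norm X \<le> L2_norm (\<lambda>x. (\<Sum>l\<in>F. c l * gabor l x) - s x) * L2_norm ?h"
    if F: "finite F" "F \<subseteq> Lambda" "{?l0, ?l1} \<subseteq> F" for F
  proof -
    define S where "S x = (\<Sum>l\<in>F. c l * gabor l x)" for x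
    have S: "S \<in> L2"
      unfolding S_def[abs_def] using F terms by (intro L2_sum) auto
    have "has_bochner_integral lborel (\<lambda>x. c l * (gabor l x * ?h x)) (c l * (if l \<in> {?l0, ?l1} then pairing 0 0 else 0))"
      if "l \<in> F" for l
    proof -
      obtain m n where l: "l = (of_int m, of_int n)"
        using \<open>l \<in> F\<close> F(2) unfolding Lambda_def by (auto elim!: Ints_cases)
      have "(l \<in> {?l0, ?l1}) = (m = p \<and> (n = q \<or> n = q + 1))"
        unfolding l by (auto simp del: of_int_add)
      then show ?thesis
        using gabor_dual_pair_lattice[of m n p q] unfolding l by (intro has_bochner_integral_mult_right) simp
    qed
    then have "has_bochner_integral lborel (\<lambda>x. \<Sum>l\<in>F. c l * (gabor l x * ?h x))
        (\<Sum>l\<in>F. c l * (if l \<in> {?l0, ?l1} then pairing 0 0 else 0))"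
      by (rule has_bochner_integral_sum)
    also have "(\<lambda>x. \<Sum>l\<in>F. c l * (gabor l x * ?h x)) = (\<lambda>x. S x * ?h x)"
      by (simp add: S_def sum_distrib_right mult.assoc)
    also have "(\<Sum>l\<in>F. c l * (if l \<in> {?l0, ?l1} then pairing 0 0 else 0)) = (\<Sum>l\<in>{?l0, ?l1}. c l * pairing 0 0)"
      using F by (intro sum.mono_neutral_cong_right) auto
    also have "\<dots> = pairing 0 0 * (c ?l0 + c ?l1)"
      by (simp add: algebra_simps)
    finally have "(LINT x|lborel. S x * ?h x) = pairing 0 0 * (c ?l0 + c ?l1)"
      by (simp add: has_bochner_integral_iff)
    then have "X = (LINT x|lborel. S x * ?h x) - (LINT x|lborel. s x * ?h x)"
      unfolding X_def by simp
    also have "\<dots> = (LINT x|lborel. (S x - s x) * ?h x)"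
      using S s h by (simp add: L2_mult_integrable left_diff_distrib)
    finally show ?thesis
      using L2_Cauchy_Schwarz[OF L2_diff[OF S s] h] unfolding S_def by simp
  qed
  have "eventually (\<lambda>F. norm X \<le> L2_norm (\<lambda>x. (\<Sum>l\<in>F. c l * gabor l x) - s x) * L2_norm ?h) (finite_subsets_at_top Lambda)"
    unfolding eventually_finite_subsets_at_top using bound in_Lambda
    by (intro exI[of _ "{?l0, ?l1}"]) auto
  moreover have "((\<lambda>F. L2_norm (\<lambda>x. (\<Sum>l\<in>F. c l * gabor l x) - s x) * L2_norm ?h) \<longlongrightarrow> 0 * L2_norm ?h) (finite_subsets_at_top Lambda)"
    by (intro tendsto_mult lim tendsto_const)
  ultimately have "norm X \<le> 0"
    using tendsto_lowerbound[OF _ _ finite_subsets_at_top_neq_bot] by fastforce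
  then have "(LINT x|lborel. s x * ?h x) = pairing 0 0 * (c ?l0 + c ?l1)"
    by (simp add: X_def)
  moreover have "(LINT x|lborel. s x * ?h x) = (LINT x|lborel. - b * (gabor sharp x * ?h x))"
  proof (rule integral_cong_AE)
    note [measurable] = L2_measurable[OF s] L2_measurable[OF h]
    show "(\<lambda>x. s x * ?h x) \<in> borel_measurable lborel"
      by measurable
    show "(\<lambda>x. - b * (gabor sharp x * ?h x)) \<in> borel_measurable lborel"
      unfolding sharp_def by measurable
    show "AE x in lborel. s x * ?h x = - b * (gabor sharp x * ?h x)"
      using assms(2)
    proof eventually_elim
      case (elim x)
      then have "s x = - (b * gabor sharp x)"
        by (simp add: eq_neg_iff_add_eq_0 add.commute)
      then show ?case by simp
    qed
  qed
  moreover have "(LINT x|lborel. - b * (gabor sharp x * ?h x)) = - b * (sharp_pairing p q + sharp_pairing p (q + 1))"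
    using gabor_dual_pair[of "1/2" "1/2" "of_int p" "of_int q"]
    unfolding sharp_def sharp_pairing_def by (simp add: has_bochner_integral_iff)
  ultimately show ?thesis by simp
qed

section \<open>Size of the coefficients and the final comparison\<close>

lemma norm_sharp_pairing:
  obtains \<kappa> where "\<kappa> > 0"
    "\<And>p q. norm (sharp_pairing p q) = \<kappa> / sqrt ((of_int p - 1/2)\<^sup>2 + (of_int q - 1/2)\<^sup>2)"
proof -
  obtain \<kappa> where \<kappa>: "\<kappa> > 0"
    "\<And>M N. norm (pairing (of_int M + 1/2) (of_int N + 1/2)) = \<kappa> / norm (Complex (of_int M + 1/2) (of_int N + 1/2))"
    using pairing_half_int by blast
  have "norm (sharp_pairing p q) = \<kappa> / sqrt ((of_int p - 1/2)\<^sup>2 + (of_int q - 1/2)\<^sup>2)" for p q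
    \<comment> \<open>1/2 - p is -p + 1/2, hence the negated indices.\<close>
    using \<kappa>(2)[of "- p" "- q"]
    by (simp add: sharp_pairing_def norm_mult complex_norm power2_commute)
  with \<kappa>(1) show ?thesis by (rule that)
qed

lemma sharp_pairing_tendsto_0: "(\<lambda>k. sharp_pairing p (q + int k)) \<longlonglongrightarrow> 0"
proof -
  obtain \<kappa> where \<kappa>: "\<kappa> > 0"
    "\<And>p q. norm (sharp_pairing p q) = \<kappa> / sqrt ((of_int p - 1/2)\<^sup>2 + (of_int q - 1/2)\<^sup>2)"
    using norm_sharp_pairing by blast
  have "(\<lambda>k. \<kappa> / sqrt ((P - 1/2)\<^sup>2 + (Q + real k - 1/2)\<^sup>2)) \<longlonglongrightarrow> 0" for P Q
    by real_asymp
  from this[of "of_int p" "of_int q"] have "(\<lambda>k. norm (sharp_pairing p (q + int k))) \<longlonglongrightarrow> 0"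
    unfolding \<kappa>(2) by simp
  then show ?thesis
    by (rule tendsto_norm_zero_cancel)
qed

text \<open>A column is an injective image of the naturals, so the squared moduli along it form a
  convergent series.\<close>

lemma little_l2_column_tendsto_0:
  assumes "little_l2 c Lambda"
  shows "(\<lambda>k. c (of_int p, of_int (q + int k))) \<longlonglongrightarrow> 0"
proof -
  define h where "h k = (real_of_int p, real_of_int (q + int k))" for k
  have "(\<lambda>l. (cmod (c l))\<^sup>2) summable_on range h"
    using assms unfolding little_l2_def
    by (rule summable_on_subset_banach) (auto simp: h_def Lambda_def)
  moreover have "inj h"
    by (auto simp: inj_def h_def)
  ultimately have "((\<lambda>l. (cmod (c l))\<^sup>2) \<circ> h) summable_on UNIV"
    by (simp add: summable_on_reindex)
  then have "(\<lambda>k. (cmod (c (h k)))\<^sup>2) \<longlonglongrightarrow> 0"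
    unfolding o_def by (intro summable_LIMSEQ_zero summable_on_imp_summable)
  then have "(\<lambda>k. sqrt ((cmod (c (h k)))\<^sup>2)) \<longlonglongrightarrow> sqrt 0"
    by (rule tendsto_real_sqrt)
  then show ?thesis
    by (simp add: h_def tendsto_norm_zero_iff)
qed

text \<open>The two-term relation only says that \<open>D\<close> changes sign at each step; its
  modulus is thus constant along a column, and decay forces it to be 0.\<close>

lemma coefficient_formula:
  assumes "little_l2 c Lambda"
    and "has_sum_L2 (\<lambda>l x. c l * gabor l x) s Lambda"
    and "AE x in lborel. b * gabor sharp x + s x = 0"
  shows "pairing 0 0 * c (of_int p, of_int q) = - b * sharp_pairing p q"
proof -
  define D where "D k = pairing 0 0 * c (of_int p, of_int (q + int k)) + b * sharp_pairing p (q + int k)" for k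
  have "D (Suc k) = - D k" for k
    using coefficient_relation[OF assms(2,3), of p "q + int k"]
    unfolding D_def by (simp add: algebra_simps) (simp add: eq_neg_iff_add_eq_0 algebra_simps)
  then have "norm (D k) = norm (D 0)" for k
    by (induction k) auto
  then obtain d where d: "norm (D k) = d" for k
    by blast
  have "D \<longlonglongrightarrow> pairing 0 0 * 0 + b * 0"
    unfolding D_def by (intro tendsto_intros little_l2_column_tendsto_0 sharp_pairing_tendsto_0 assms)
  then have "(\<lambda>k. norm (D k)) \<longlonglongrightarrow> 0"
    by (simp add: tendsto_norm_zero)
  then have "d = 0"
    by (simp add: d LIMSEQ_const_iff)
  with d[of 0] have "D 0 = 0"
    by simp
  then show ?thesis
    by (simp add: D_def eq_neg_iff_add_eq_0)
qed

text \<open>In the triangle 1 <= q <= p each value is at least K / (2 p^2). Row p has p points, so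
  the row sums dominate a harmonic series.\<close>

lemma not_summable_inverse_square_lattice:
  fixes f :: "real \<times> real \<Rightarrow> real"
  assumes "\<And>p q. f (of_int p, of_int q) = K / ((of_int p - 1/2)\<^sup>2 + (of_int q - 1/2)\<^sup>2)" "K > 0"
  shows "\<not> f summable_on Lambda"
proof
  assume sum: "f summable_on Lambda"
  \<comment> \<open>Indices start at 0 and \<open>h\<close> adds one to each, so row
    \<open>p\<close> has \<open>Suc p\<close> points.\<close>
  define T where "T = (SIGMA p:UNIV. {..<Suc p})"
  define h :: "nat \<times> nat \<Rightarrow> real \<times> real" where "h = (\<lambda>(p, q). (of_int (int (Suc p)), of_int (int (Suc q))))"
  have "inj_on h T"
    by (auto simp: inj_on_def h_def)
  moreover have "f summable_on h ` T"
    using sum by (rule summable_on_subset_banach) (auto simp: h_def Lambda_def)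
  ultimately have "(f \<circ> h) summable_on T"
    by (simp add: summable_on_reindex)
  then have "(\<lambda>(p, q). K / (2 * (real (Suc p))\<^sup>2)) summable_on T"
  proof (rule summable_on_comparison_test)
    fix x assume "x \<in> T"
    then obtain p q where x: "x = (p, q)" and "q \<le> p"
      by (auto simp: T_def less_Suc_eq_le)
    have "(real (Suc p) - 1/2)\<^sup>2 \<le> (real (Suc p))\<^sup>2" "(real (Suc q) - 1/2)\<^sup>2 \<le> (real (Suc p))\<^sup>2"
      using \<open>q \<le> p\<close> by (auto intro!: power_mono)
    then have "(real (Suc p) - 1/2)\<^sup>2 + (real (Suc q) - 1/2)\<^sup>2 \<le> 2 * (real (Suc p))\<^sup>2"
      by linarith
    moreover have "0 < (real (Suc p) - 1/2)\<^sup>2 + (real (Suc q) - 1/2)\<^sup>2"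
      by (intro add_pos_nonneg) auto
    ultimately have "K / (2 * (real (Suc p))\<^sup>2) \<le> K / ((real (Suc p) - 1/2)\<^sup>2 + (real (Suc q) - 1/2)\<^sup>2)"
      using assms(2) by (intro divide_left_mono mult_pos_pos) (simp_all del: of_nat_Suc)
    then show "(case x of (p, q) \<Rightarrow> K / (2 * (real (Suc p))\<^sup>2)) \<le> (f \<circ> h) x"
      unfolding x h_def o_def prod.case assms(1) by simp
  qed (use assms(2) in auto)
  then have "(\<lambda>p. infsum (\<lambda>q. K / (2 * (real (Suc p))\<^sup>2)) {..<Suc p}) summable_on UNIV"
    unfolding T_def by (drule_tac summable_on_SigmaD) auto
  then have "summable (\<lambda>p. real (Suc p) * (K / (2 * (real (Suc p))\<^sup>2)))"
    by (auto dest!: summable_on_imp_summable)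
  also have "(\<lambda>p. real (Suc p) * (K / (2 * (real (Suc p))\<^sup>2))) = (\<lambda>p. K / 2 * inverse (real (Suc p)))"
    by (rule ext) (simp add: power2_eq_square field_simps del: of_nat_Suc)
  finally have "summable (\<lambda>p. inverse (real (Suc p)))"
    using assms(2) by (simp only: summable_cmult_iff) auto
  then show False
    using not_summable_harmonic[where ?'a = real] summable_Suc_iff[of "\<lambda>n. inverse (real n)"] by simp
qed

theorem proposition7p1:
  fixes c :: "real \<times> real \<Rightarrow> complex" and b :: complex and s :: "real \<Rightarrow> complex"
  assumes "little_l2 c Lambda"
    and "has_sum_L2 (\<lambda>l x. c l * gabor l x) s Lambda"
    and "AE x in lborel. b * gabor sharp x + s x = 0"
  shows "\<forall>l\<in>Lambda. c l = 0"
proof -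
  obtain \<kappa> where \<kappa>: "\<kappa> > 0"
    "\<And>p q. norm (sharp_pairing p q) = \<kappa> / sqrt ((of_int p - 1/2)\<^sup>2 + (of_int q - 1/2)\<^sup>2)"
    using norm_sharp_pairing by blast
  have c: "c (of_int p, of_int q) = - b * sharp_pairing p q / pairing 0 0" for p q
    using coefficient_formula[OF assms, of p q] pairing_0_0_nonzero by (simp add: field_simps)
  \<comment> \<open>For nonzero \<open>b\<close> the squared coefficients would be exactly a
    positive constant over the squared distance to \<open>sharp\<close>, against
    \<open>little_l2\<close>. Once \<open>b = 0\<close>, the formula for \<open>c\<close> gives the
    claim.\<close>
  have "b = 0"
  proof (rule ccontr)
    assume "b \<noteq> 0"
    define K where "K = (norm b * \<kappa> / norm (pairing 0 0))\<^sup>2"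
    have "K > 0"
      using \<open>b \<noteq> 0\<close> \<kappa>(1) pairing_0_0_nonzero by (simp add: K_def)
    moreover have "(cmod (c (of_int p, of_int q)))\<^sup>2 = K / ((of_int p - 1/2)\<^sup>2 + (of_int q - 1/2)\<^sup>2)" for p q
      unfolding c by (simp add: K_def norm_mult norm_divide \<kappa>(2) power_mult_distrib power_divide)
    ultimately show False
      using not_summable_inverse_square_lattice[of "\<lambda>l. (cmod (c l))\<^sup>2" K] assms(1)
      unfolding little_l2_def by blast
  qed
  then show ?thesis
    using c unfolding Lambda_def by (auto elim!: Ints_cases)
qed

end
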